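(* Let $p\in(0,\beta]$ and $\mathcal{P}=\mathcal{P}(\mu,s,\beta,\varphi)$. The worst-case values $\inf_{\mathbb{P}\in\mathcal{P}}\mathrm{CR}(p,\mathbb{P})$ and $\inf_{\mathbb{P}\in\mathcal{P}}\mathrm{REV}(p,\mathbb{P})$ are asymptotically attained by the same limiting distribution; that is, there exists a sequence $(\mathbb{P}_n)_{n\ge1}$ with $\mathbb{P}_n\in\mathcal{P}$ for all $n$ such that $$\lim_{n\to\infty}\mathrm{CR}(p,\mathbb{P}_n)=\inf_{\mathbb{P}\in\mathcal{P}}\mathrm{CR}(p,\mathbb{P})\quad\text{and}\quad \lim_{n\to\infty}\mathrm{REV}(p,\mathbb{P}_n)=\inf_{\mathbb{P}\in\mathcal{P}}\mathrm{REV}(p,\mathbb{P}).$$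
   Context: Let $0<\mu<\beta<\infty$, let $\varphi:[0,\beta]\to\mathbb{R}_{\ge 0}$ be strictly convex and differentiable, and let $s\in\mathbb{R}$. The ambiguity set $\mathcal{P}(\mu,s,\beta,\varphi)$ is the set of all probability distributions $\mathbb{P}$ of a real random variable $X$ with $\mathbb{P}(X\in[0,\beta])=1$, $\mathbb{E}_{\mathbb{P}}(X)=\mu$ and $\mathbb{E}_{\mathbb{P}}(\varphi(X))=s$. Standing assumptions: $s>\varphi(\mu)$, and $\tau_2<\beta$, where $\tau_2>0$ is the solution of $\frac{\varphi(\tau_2)-\varphi(0)}{\tau_2}=\frac{s-\varphi(0)}{\mu}$. For a price $p>0$: $\mathrm{REV}(p,\mathbb{P})=p\,\mathbb{P}(X\ge p)$, $\mathrm{OPT}(\mathbb{P})=\sup_{t>0}t\,\mathbb{P}(X\ge t)$, and $\mathrm{CR}(p,\mathbb{P})=\mathrm{REV}(p,\mathbb{P})/\mathrm{OPT}(\mathbb{P})$. A limiting distribution, represented by a sequence of distributions $\mathbb{P}_n\in\mathcal{P}$, asymptotically attains an infimum if the objective values along the sequence converge to that infimum. *)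

theory Defs
  imports "HOL-Probability.Probability"
begin

definition strictly_convex_on :: "real set \<Rightarrow> (real \<Rightarrow> real) \<Rightarrow> bool" where
  "strictly_convex_on S f \<longleftrightarrow> convex S \<and>
     (\<forall>x\<in>S. \<forall>y\<in>S. \<forall>u. x \<noteq> y \<longrightarrow> 0 < u \<longrightarrow> u < 1 \<longrightarrow>
        f ((1 - u) * x + u * y) < (1 - u) * f x + u * f y)"

text \<open>
  A distribution is a probability measure on the Borel sets of the reals. As \<open>\<phi>\<close> only matters
  on \<open>{0..\<beta>}\<close>, which carries all the mass, its expectation is taken over that set; values of
  \<open>\<phi>\<close> outside are irrelevant. For \<open>\<phi>\<close> continuous on \<open>{0..\<beta>}\<close>, both integrands
  are integrable, so neither integral condition is affected by the default value 0 of
  the Bochner integral.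
\<close>
definition ambiguity_set ::
    "real \<Rightarrow> real \<Rightarrow> real \<Rightarrow> (real \<Rightarrow> real) \<Rightarrow> real measure set" where
  "ambiguity_set \<mu> s \<beta> \<phi> =
     {M. real_distribution M \<and> measure M {0..\<beta>} = 1 \<and>
         (LINT x|M. x) = \<mu> \<and> (LINT x:{0..\<beta>}|M. \<phi> x) = s}"

definition REV :: "real \<Rightarrow> real measure \<Rightarrow> real" where
  "REV p M = p * measure M {p..}"

text \<open>
  On the ambiguity set the supremum is over a set bounded above by \<open>\<beta>\<close>, and it is positive
  because the mean is, so the real supremum and the quotient below are the genuine ones.
\<close>
definition OPT :: "real measure \<Rightarrow> real" where
  "OPT M = (SUP t\<in>{0<..}. t * measure M {t..})"

definition CR :: "real \<Rightarrow> real measure \<Rightarrow> real" where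
  "CR p M = REV p M / OPT M"

end

theory Submission
  imports Defs
begin

text \<open>
  Unless the price \<open>p\<close> is so high that both infima are 0, they are governed by one law \<open>Q\<close> with at
  most three atoms, one of which lies exactly at \<open>p\<close>. A customer with valuation \<open>p\<close> buys, so \<open>Q\<close>
  itself misses the infima, but customers slightly below \<open>p\<close> do not, and laws whose atom tends to
  \<open>p\<close> from the left approach them. Three regimes arise, with \<open>\<tau>\<close> short for \<open>\<tau>\<^sub>2\<close>.

  \<^item> If \<open>p > \<tau>\<close>, the admissible law on \<open>{0, \<tau>}\<close> never sells, and both infima are 0
    (\<open>high_price\<close>).

  \<^item> If \<open>p \<le> \<tau>\<close>, the weights on the atoms \<open>0\<close>, \<open>p\<close>, \<open>\<beta>\<close> are determined by the moment
    constraints. When they are all nonnegative, this law is \<open>Q\<close>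
    (\<open>price_up_to_threshold\<close>).

  \<^item> Otherwise only the weight at \<open>0\<close> is negative. Then \<open>p < \<mu>\<close>, and some \<open>z < \<beta>\<close> makes the law on
    the two atoms \<open>p\<close>, \<open>z\<close> with mean \<open>\<mu>\<close> satisfy the second constraint (\<open>low_price\<close>).

  In the last two regimes write \<open>w\<^sub>p\<close> and \<open>w\<^sub>z\<close> for the weights of \<open>Q\<close> at \<open>p\<close> and at its upper atom
  \<open>z\<close> (\<open>z = \<beta>\<close> in the second regime), and put \<open>V = max (p (w\<^sub>p + w\<^sub>z)) (z w\<^sub>z)\<close>, the optimal
  revenue under \<open>Q\<close>. The values of the infima are \<open>p w\<^sub>z\<close> and \<open>p w\<^sub>z / V\<close>.

  The lower bounds say that every admissible \<open>M\<close> satisfies \<open>w\<^sub>z \<le> M {p..}\<close> and, for all \<open>t > 0\<close>,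
  \<open>w\<^sub>z t M {t..} \<le> V M {p..}\<close>; dividing the second by \<open>OPT M\<close> bounds the competitive ratio. They
  are duality arguments: a function \<open>A + B x + C \<phi> x\<close> has the same expectation under all
  admissible laws, and a comparison of it on \<open>{0..\<beta>}\<close> with a combination of indicators of upper
  rays turns into an inequality between tail probabilities (\<open>expectation_le\<close>). The multipliers
  are chosen so that the comparison becomes tight on the atoms of \<open>Q\<close>, with the one at \<open>p\<close>
  approached from the left, and strict convexity of \<open>\<phi>\<close>
  gives it elsewhere (\<open>lower_bounds_two_atoms\<close>, \<open>lower_bounds_three_atoms\<close>).

  Attainment is a perturbation argument. Sliding the atom at \<open>p\<close> down to \<open>q < p\<close> spoils both
  moments slightly, and mixing in a small multiple of a law on \<open>{0, \<mu>, \<beta>}\<close> restores them: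
  the standing assumptions place \<open>(\<mu>, s)\<close> strictly inside the triangle spanned by the points of
  the graph of \<open>\<phi>\<close> over \<open>0\<close>, \<open>\<mu>\<close>, \<open>\<beta>\<close>, so small corrections keep the weights positive
  (\<open>approximating_law\<close>).
\<close>

section \<open>Laws with finitely many atoms\<close>

text \<open>
  The first component of each pair is an atom and the second its weight; an atom may be listed
  several times. The image under the identity replaces the discrete \<open>\<sigma>\<close>-algebra of the mass
  function by the Borel sets.
\<close>

definition atomic_law :: "(real \<times> real) list \<Rightarrow> real measure" where
  "atomic_law xs = distr (measure_pmf (pmf_of_list xs)) borel (\<lambda>x. x)"

lemma real_distribution_atomic_law: "real_distribution (atomic_law xs)"
  unfolding atomic_law_def
  by (intro prob_space.real_distribution_distr prob_space_measure_pmf) simp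

lemma measure_atomic_law:
  assumes "pmf_of_list_wf xs" and "A \<in> sets borel"
  shows "measure (atomic_law xs) A = sum_list (map snd (filter (\<lambda>x. fst x \<in> A) xs))"
  unfolding atomic_law_def using assms by (simp add: measure_distr measure_pmf_of_list)

lemma sum_fibres_weighted_list:
  fixes f :: "real \<Rightarrow> real"
  assumes "finite A" and "fst ` set xs \<subseteq> A"
  shows "(\<Sum>a\<in>A. f a * sum_list (map snd (filter (\<lambda>z. fst z = a) xs)))
    = sum_list (map (\<lambda>z. f (fst z) * snd z) xs)"
  using assms(2)
proof (induction xs)
  case (Cons z xs)
  have "(\<Sum>a\<in>A. f a * sum_list (map snd (filter (\<lambda>z. fst z = a) (z # xs))))
      = (\<Sum>a\<in>A. (if a = fst z then f a * snd z else 0)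
          + f a * sum_list (map snd (filter (\<lambda>z. fst z = a) xs)))"
    by (intro sum.cong) (auto simp: algebra_simps)
  also have "\<dots> = f (fst z) * snd z + sum_list (map (\<lambda>z. f (fst z) * snd z) xs)"
    using Cons assms(1) by (simp add: sum.distrib sum.delta)
  finally show ?case by simp
qed simp

lemma integral_atomic_law:
  fixes f :: "real \<Rightarrow> real"
  assumes "pmf_of_list_wf xs" and "f \<in> borel_measurable borel"
  shows "(LINT x|atomic_law xs. f x) = sum_list (map (\<lambda>z. f (fst z) * snd z) xs)"
proof -
  have "(LINT x|atomic_law xs. f x) = (LINT x|measure_pmf (pmf_of_list xs). f x)"
    unfolding atomic_law_def using assms(2) by (subst integral_distr) auto
  also have "\<dots> = (\<Sum>a\<in>fst ` set xs. f a * pmf (pmf_of_list xs) a)"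
    using set_pmf_of_list[OF assms(1)] by (intro integral_measure_pmf_real) auto
  also have "\<dots> = sum_list (map (\<lambda>z. f (fst z) * snd z) xs)"
    by (simp add: pmf_pmf_of_list[OF assms(1)] sum_fibres_weighted_list)
  finally show ?thesis .
qed

section \<open>The moment problem\<close>

text \<open>
  Strict convexity with denominators cleared. In this form it can be compared with other chords
  by linear arithmetic.
\<close>

lemma three_chord:
  fixes f :: "real \<Rightarrow> real"
  assumes "strictly_convex_on S f" "x \<in> S" "z \<in> S" "x < y" "y < z"
  shows "(z - x) * f y < (z - y) * f x + (y - x) * f z"
proof -
  define u where "u = (y - x) / (z - x)"
  have u: "0 < u" "u < 1" "(z - x) * u = y - x"
    using assms by (auto simp: u_def field_simps)
  have "f ((1 - u) * x + u * z) < (1 - u) * f x + u * f z"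
    using u assms by (auto simp: strictly_convex_on_def)
  also have "(1 - u) * x + u * z = y" using u by (simp add: algebra_simps)
  finally have "(z - x) * f y < (z - x) * ((1 - u) * f x + u * f z)"
    using assms by simp
  also have "\<dots> = ((z - x) - (z - x) * u) * f x + ((z - x) * u) * f z"
    by (simp add: algebra_simps)
  finally show ?thesis using u by simp
qed

text \<open>
  The last assumption puts \<open>s\<close> strictly below the chord of \<open>\<phi>\<close> over \<open>{0..\<beta>}\<close> at \<open>\<mu>\<close>; this is what
  \<open>\<tau>\<^sub>2 < \<beta>\<close> amounts to.
\<close>

locale moment_problem =
  fixes \<mu> s \<beta> :: real and \<phi> :: "real \<Rightarrow> real"
  assumes mean_pos: "0 < \<mu>" and mean_less: "\<mu> < \<beta>"
    and strictly_convex: "strictly_convex_on {0..\<beta>} \<phi>"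
    and differentiable: "\<phi> differentiable_on {0..\<beta>}"
    and above_graph: "\<phi> \<mu> < s"
    and below_chord: "\<beta> * (s - \<phi> 0) < \<mu> * (\<phi> \<beta> - \<phi> 0)"
begin

abbreviation laws :: "real measure set" where
  "laws \<equiv> ambiguity_set \<mu> s \<beta> \<phi>"

lemma continuous: "continuous_on {0..\<beta>} \<phi>"
  using differentiable by (rule differentiable_imp_continuous_on)

text \<open>
  The derivative supplies a supporting line by convexity. If it touched the graph at a second
  point, strict convexity would push the graph below it at the midpoint.
\<close>

lemma strict_tangent:
  assumes "0 < a" "a < \<beta>"
  obtains c where "\<And>x. x \<in> {0..\<beta>} \<Longrightarrow> x \<noteq> a \<Longrightarrow> \<phi> a + c * (x - a) < \<phi> x"
proof -
  have conv: "convex_on {0..\<beta>} \<phi>"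
  proof (rule convex_onI)
    fix u x y :: real
    assume H: "0 < u" "u < 1" "x \<in> {0..\<beta>}" "y \<in> {0..\<beta>}"
    show "\<phi> ((1 - u) *\<^sub>R x + u *\<^sub>R y) \<le> (1 - u) * \<phi> x + u * \<phi> y"
    proof (cases "x = y")
      case True
      then show ?thesis by (simp add: algebra_simps)
    next
      case False
      then show ?thesis using strictly_convex H
        by (auto simp: strictly_convex_on_def intro!: less_imp_le)
    qed
  qed simp
  have "\<phi> field_differentiable (at a within {0..\<beta>})"
    using differentiable assms
    by (auto simp: differentiable_on_def real_differentiable_def field_differentiable_def)
  then obtain c where c: "(\<phi> has_field_derivative c) (at a within {0..\<beta>})"
    by (auto simp: field_differentiable_def)
  have le: "c * (x - a) \<le> \<phi> x - \<phi> a" if "x \<in> {0..\<beta>}" for x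
    by (rule convex_on_imp_above_tangent[OF conv _ _ that c]) (use assms in auto)
  have "\<phi> a + c * (x - a) < \<phi> x" if "x \<in> {0..\<beta>}" "x \<noteq> a" for x
  proof -
    let ?m = "(1 - 1/2) * a + (1/2) * x"
    have "\<phi> ?m < (1 - 1/2) * \<phi> a + (1/2) * \<phi> x"
    proof -
      have "\<And>u. 0 < u \<Longrightarrow> u < 1 \<Longrightarrow> \<phi> ((1 - u) * a + u * x) < (1 - u) * \<phi> a + u * \<phi> x"
        using strictly_convex that assms unfolding strictly_convex_on_def by auto
      from this[of "1/2"] show ?thesis by simp
    qed
    moreover have "c * (?m - a) \<le> \<phi> ?m - \<phi> a"
      using that assms by (intro le) auto
    ultimately show ?thesis by (simp add: algebra_simps)
  qed
  then show ?thesis using that by blast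
qed

text \<open>
  Weak duality for the moment problem: the left-hand integrand depends on the law only through
  the two prescribed moments. Two rays suffice because each later bound compares the tail at the
  price with the tail at one competing price; a spare ray gets the coefficient 0.
\<close>

lemma expectation_le:
  assumes M: "M \<in> laws"
    and le: "\<And>x. 0 \<le> x \<Longrightarrow> x \<le> \<beta> \<Longrightarrow>
      A + B * x + C * \<phi> x \<le> k + k1 * indicator {t1..} x + k2 * indicator {t2..} x"
  shows "A + B * \<mu> + C * s \<le> k + k1 * measure M {t1..} + k2 * measure M {t2..}"
proof -
  interpret real_distribution M using M by (simp add: ambiguity_set_def)
  have moments: "(LINT x|M. x) = \<mu>" "(LINT x|M. indicator {0..\<beta>} x * \<phi> x) = s"
    using M by (auto simp: ambiguity_set_def set_lebesgue_integral_def)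
  have AE: "AE x in M. x \<in> {0..\<beta>}"
    using M by (intro AE_prob_1) (simp add: ambiguity_set_def)
  have int_id: "integrable M (\<lambda>x. x)"
    using AE by (intro integrable_const_bound[where B=\<beta>]) auto
  obtain K where K: "\<And>x. x \<in> {0..\<beta>} \<Longrightarrow> \<bar>\<phi> x\<bar> \<le> K"
    using compact_imp_bounded[OF compact_continuous_image[OF continuous compact_Icc]]
    unfolding bounded_iff real_norm_def by blast
  have "(\<lambda>x. indicator {0..\<beta>} x * \<phi> x) \<in> borel_measurable borel"
    using borel_measurable_continuous_on_indicator[OF _ continuous] by simp
  then have int_phi: "integrable M (\<lambda>x. indicator {0..\<beta>} x * \<phi> x)"
  proof (intro integrable_const_bound[where B=K])
    show "AE x in M. norm (indicator {0..\<beta>} x * \<phi> x) \<le> K"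
      by (rule eventually_mono[OF AE]) (use K in simp)
  qed simp
  have int_ind: "integrable M (indicator {t..} :: real \<Rightarrow> real)" for t
    by (intro integrable_real_indicator) (auto simp: emeasure_eq_measure)
  have ind: "(LINT x|M. indicator {t..} x) = measure M {t..}" for t
    by simp
  have "(LINT x|M. A + B * x + C * (indicator {0..\<beta>} x * \<phi> x))
      \<le> (LINT x|M. k + k1 * indicator {t1..} x + k2 * indicator {t2..} x)"
  proof (rule integral_mono_AE)
    show "AE x in M. A + B * x + C * (indicator {0..\<beta>} x * \<phi> x)
        \<le> k + k1 * indicator {t1..} x + k2 * indicator {t2..} x"
      by (rule eventually_mono[OF AE]) (use le in simp)
  qed (use int_id int_phi int_ind in simp_all)
  also have "(LINT x|M. A + B * x + C * (indicator {0..\<beta>} x * \<phi> x)) = A + B * \<mu> + C * s"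
    using int_id int_phi moments prob_space by simp
  also have "(LINT x|M. k + k1 * indicator {t1..} x + k2 * indicator {t2..} x)
      = k + k1 * measure M {t1..} + k2 * measure M {t2..}"
    using int_ind ind prob_space by simp
  finally show ?thesis .
qed

lemma atomic_law_in_laws:
  assumes wf: "pmf_of_list_wf xs"
    and pts: "\<And>z. z \<in> set xs \<Longrightarrow> 0 \<le> fst z \<and> fst z \<le> \<beta>"
    and mean: "sum_list (map (\<lambda>z. fst z * snd z) xs) = \<mu>"
    and moment: "sum_list (map (\<lambda>z. \<phi> (fst z) * snd z) xs) = s"
  shows "atomic_law xs \<in> laws"
proof -
  have "(\<lambda>x. indicator {0..\<beta>} x * \<phi> x) \<in> borel_measurable borel"
    using borel_measurable_continuous_on_indicator[OF _ continuous] by simp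
  then have "(LINT x:{0..\<beta>}|atomic_law xs. \<phi> x)
      = sum_list (map (\<lambda>z. indicator {0..\<beta>} (fst z) * \<phi> (fst z) * snd z) xs)"
    by (simp add: set_lebesgue_integral_def integral_atomic_law[OF wf])
  also have "\<dots> = s"
    unfolding moment[symmetric] using pts by (intro arg_cong[where f=sum_list] map_cong) auto
  finally have "(LINT x:{0..\<beta>}|atomic_law xs. \<phi> x) = s" .
  moreover have "(LINT x|atomic_law xs. x) = \<mu>"
    using integral_atomic_law[OF wf, of "\<lambda>x. x"] mean by simp
  moreover have "filter (\<lambda>z. fst z \<in> {0..\<beta>}) xs = xs"
    using pts by (auto intro: filter_True)
  then have "measure (atomic_law xs) {0..\<beta>} = 1"
    using wf by (simp add: measure_atomic_law pmf_of_list_wf_def)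
  ultimately show ?thesis
    by (simp add: ambiguity_set_def real_distribution_atomic_law)
qed

section \<open>Laws on three atoms with prescribed moments\<close>

text \<open>
  Exactly one signed measure on \<open>{0, a, \<beta>}\<close> has total mass 1, mean \<open>m\<close> and \<open>\<phi>\<close>-moment \<open>\<sigma>\<close>. Its
  weights at \<open>a\<close> and \<open>\<beta>\<close> come from Cramer's rule, with \<open>gap a\<close> the determinant of the system.
\<close>

definition gap :: "real \<Rightarrow> real" where
  "gap a = a * (\<phi> \<beta> - \<phi> 0) - \<beta> * (\<phi> a - \<phi> 0)"

definition mid_weight :: "real \<Rightarrow> real \<Rightarrow> real \<Rightarrow> real" where
  "mid_weight a m \<sigma> = (m * (\<phi> \<beta> - \<phi> 0) - \<beta> * (\<sigma> - \<phi> 0)) / gap a"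

definition end_weight :: "real \<Rightarrow> real \<Rightarrow> real \<Rightarrow> real" where
  "end_weight a m \<sigma> = (a * (\<sigma> - \<phi> 0) - m * (\<phi> a - \<phi> 0)) / gap a"

text \<open>
  The determinant is \<open>\<beta>\<close> times the height of the chord of \<open>\<phi>\<close> over \<open>{0..\<beta>}\<close> above the graph at \<open>a\<close>.
\<close>

lemma gap_pos:
  assumes "0 < a" "a < \<beta>"
  shows "0 < gap a"
  using three_chord[OF strictly_convex _ _ assms] assms by (simp add: gap_def algebra_simps)

lemma weights_moments:
  assumes "0 < a" "a < \<beta>"
  shows "a * mid_weight a m \<sigma> + \<beta> * end_weight a m \<sigma> = m"
    and "(\<phi> a - \<phi> 0) * mid_weight a m \<sigma> + (\<phi> \<beta> - \<phi> 0) * end_weight a m \<sigma> = \<sigma> - \<phi> 0"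
proof -
  have "gap a \<noteq> 0" using gap_pos[OF assms] by simp
  then show "a * mid_weight a m \<sigma> + \<beta> * end_weight a m \<sigma> = m"
    unfolding mid_weight_def end_weight_def
    by (simp add: field_simps) (simp add: gap_def algebra_simps)
  show "(\<phi> a - \<phi> 0) * mid_weight a m \<sigma> + (\<phi> \<beta> - \<phi> 0) * end_weight a m \<sigma> = \<sigma> - \<phi> 0"
    using \<open>gap a \<noteq> 0\<close> unfolding mid_weight_def end_weight_def
    by (simp add: field_simps) (simp add: gap_def algebra_simps)
qed

text \<open>
  The point \<open>(\<mu>, s)\<close> lies strictly inside the triangle spanned by the graph points over \<open>0\<close>, \<open>\<mu>\<close>, \<open>\<beta>\<close>:
  below the long chord, above the graph, and on the vertical line through the middle vertex.
\<close>

lemma interior_weights: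
  "0 < mid_weight \<mu> \<mu> s" "0 < end_weight \<mu> \<mu> s"
  "mid_weight \<mu> \<mu> s + end_weight \<mu> \<mu> s < 1"
proof -
  note g = gap_pos[OF mean_pos mean_less]
  show "0 < mid_weight \<mu> \<mu> s"
    unfolding mid_weight_def using g below_chord by simp
  have "0 < \<mu> * (s - \<phi> \<mu>)" using mean_pos above_graph by simp
  then show "0 < end_weight \<mu> \<mu> s"
    unfolding end_weight_def using g by (simp add: algebra_simps)
  have "0 < (\<beta> - \<mu>) * (s - \<phi> \<mu>)" using mean_less above_graph by simp
  then have "(\<mu> * (\<phi> \<beta> - \<phi> 0) - \<beta> * (s - \<phi> 0)) + (\<mu> * (s - \<phi> 0) - \<mu> * (\<phi> \<mu> - \<phi> 0)) < gap \<mu>"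
    by (simp add: gap_def algebra_simps)
  then show "mid_weight \<mu> \<mu> s + end_weight \<mu> \<mu> s < 1"
    unfolding mid_weight_def end_weight_def using g
    by (simp add: add_divide_distrib[symmetric])
qed

section \<open>Sliding an atom below the price\<close>

text \<open>
  The law is a mixture of the given one, with \<open>p\<close> moved to \<open>q\<close>, and a correcting law on
  \<open>{0, \<mu>, \<beta>}\<close> of weight \<open>\<epsilon>\<close>. The corrector has to have the moments \<open>d q\<close> and \<open>e q\<close> below. They tend
  to \<open>\<mu>\<close> and \<open>s\<close> as \<open>q\<close> approaches \<open>p\<close>, so its weights tend to those of an interior point and are
  positive for \<open>q\<close> close to \<open>p\<close>. Hence \<open>\<epsilon>\<close> is fixed first and \<open>q\<close> is chosen afterwards.
\<close>

lemma approximating_law: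
  fixes p z w_zero wp wz \<epsilon> :: real
  assumes p: "0 < p" "p < z" and z: "z \<le> \<beta>"
    and w: "0 \<le> w_zero" "0 \<le> wp" "0 \<le> wz" "w_zero + wp + wz = 1"
    and mean: "p * wp + z * wz = \<mu>"
    and moment: "\<phi> 0 * w_zero + \<phi> p * wp + \<phi> z * wz = s"
    and \<epsilon>: "0 < \<epsilon>" "\<epsilon> < 1"
  obtains M q where "M \<in> laws" "0 < q" "p - \<epsilon> < q"
    "measure M {p..} \<le> wz + \<epsilon>"
    "(1 - \<epsilon>) * (wp + wz) \<le> measure M {q..}"
    "(1 - \<epsilon>) * wz \<le> measure M {z..}"
proof -
  define d where "d q = \<mu> + (1 - \<epsilon>) / \<epsilon> * wp * (p - q)" for q
  define e where "e q = s + (1 - \<epsilon>) / \<epsilon> * wp * (\<phi> p - \<phi> q)" for q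
  have "continuous (at p within {0..\<beta>}) \<phi>"
    using continuous p z by (simp add: continuous_on_eq_continuous_within)
  then have "(\<phi> \<longlongrightarrow> \<phi> p) (at p within {0..\<beta>})"
    by (simp add: continuous_within)
  moreover have "at p within {0..\<beta>} = at p"
    using p z by (intro at_within_interior) auto
  ultimately have lim: "(\<phi> \<longlongrightarrow> \<phi> p) (at_left p)"
    by (auto intro: tendsto_mono[OF at_le])
  have d: "(d \<longlongrightarrow> \<mu>) (at_left p)"
    unfolding d_def using \<epsilon> by (auto intro!: tendsto_eq_intros)
  have e: "(e \<longlongrightarrow> s) (at_left p)"
    unfolding e_def using \<epsilon> by (auto intro!: tendsto_eq_intros lim)
  define km where "km q = mid_weight \<mu> (d q) (e q)" for q
  define ke where "ke q = end_weight \<mu> (d q) (e q)" for q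
  have km: "(km \<longlongrightarrow> mid_weight \<mu> \<mu> s) (at_left p)"
    unfolding km_def mid_weight_def using gap_pos[OF mean_pos mean_less]
    by (intro tendsto_intros d e) auto
  have ke: "(ke \<longlongrightarrow> end_weight \<mu> \<mu> s) (at_left p)"
    unfolding ke_def end_weight_def using gap_pos[OF mean_pos mean_less]
    by (intro tendsto_intros d e) auto
  have "eventually (\<lambda>q. 0 < km q \<and> 0 < ke q \<and> km q + ke q < 1 \<and> max 0 (p - \<epsilon>) < q \<and> q < p)
    (at_left p)"
  proof (intro eventually_conj)
    show "eventually (\<lambda>q. 0 < km q) (at_left p)"
      using order_tendstoD(1)[OF km] interior_weights by blast
    show "eventually (\<lambda>q. 0 < ke q) (at_left p)"
      using order_tendstoD(1)[OF ke] interior_weights by blast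
    show "eventually (\<lambda>q. km q + ke q < 1) (at_left p)"
      using order_tendstoD(2)[OF tendsto_add[OF km ke]] interior_weights by blast
    have "eventually (\<lambda>q. q \<in> {max 0 (p - \<epsilon>)<..<p}) (at_left p)"
      using p \<epsilon> by (intro eventually_at_leftI[where a="max 0 (p - \<epsilon>)"]) auto
    then show "eventually (\<lambda>q. max 0 (p - \<epsilon>) < q) (at_left p)"
      "eventually (\<lambda>q. q < p) (at_left p)"
      by (auto elim: eventually_mono)
  qed
  then obtain q where q: "0 < km q" "0 < ke q" "km q + ke q < 1" "0 < q" "p - \<epsilon> < q" "q < p"
    using eventually_happens'[OF trivial_limit_at_left_real] by fastforce
  define xs where "xs = [(0, (1 - \<epsilon>) * w_zero), (q, (1 - \<epsilon>) * wp), (z, (1 - \<epsilon>) * wz),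
    (0, \<epsilon> * (1 - km q - ke q)), (\<mu>, \<epsilon> * km q), (\<beta>, \<epsilon> * ke q)]"
  have wf: "pmf_of_list_wf xs"
  proof (rule pmf_of_list_wfI)
    show "0 \<le> x" if "x \<in> set (map snd xs)" for x
      using that w q \<epsilon> unfolding xs_def by auto
    have "sum_list (map snd xs) = (1 - \<epsilon>) * (w_zero + wp + wz) + \<epsilon>"
      by (simp add: xs_def algebra_simps)
    then show "sum_list (map snd xs) = 1" using w by simp
  qed
  have k: "\<mu> * km q + \<beta> * ke q = d q"
    "(\<phi> \<mu> - \<phi> 0) * km q + (\<phi> \<beta> - \<phi> 0) * ke q = e q - \<phi> 0"
    unfolding km_def ke_def by (rule weights_moments[OF mean_pos mean_less])+
  have "atomic_law xs \<in> laws"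
  proof (rule atomic_law_in_laws[OF wf])
    show "0 \<le> fst y \<and> fst y \<le> \<beta>" if "y \<in> set xs" for y
      using that p z q mean_pos mean_less unfolding xs_def by auto
    have "sum_list (map (\<lambda>y. fst y * snd y) xs)
        = (1 - \<epsilon>) * (q * wp + z * wz) + \<epsilon> * (\<mu> * km q + \<beta> * ke q)"
      by (simp add: xs_def algebra_simps)
    also have "\<dots> = (1 - \<epsilon>) * (p * wp + z * wz) + \<epsilon> * \<mu>"
      unfolding k d_def using \<epsilon> by (simp add: field_simps)
    also have "\<dots> = \<mu>" unfolding mean by (simp add: algebra_simps)
    finally show "sum_list (map (\<lambda>y. fst y * snd y) xs) = \<mu>" .
    have "sum_list (map (\<lambda>y. \<phi> (fst y) * snd y) xs)
        = (1 - \<epsilon>) * (\<phi> 0 * w_zero + \<phi> q * wp + \<phi> z * wz)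
          + \<epsilon> * (\<phi> 0 + ((\<phi> \<mu> - \<phi> 0) * km q + (\<phi> \<beta> - \<phi> 0) * ke q))"
      by (simp add: xs_def algebra_simps)
    also have "\<dots> = (1 - \<epsilon>) * (\<phi> 0 * w_zero + \<phi> p * wp + \<phi> z * wz) + \<epsilon> * s"
      unfolding k e_def using \<epsilon> by (simp add: field_simps)
    also have "\<dots> = s" unfolding moment by (simp add: algebra_simps)
    finally show "sum_list (map (\<lambda>y. \<phi> (fst y) * snd y) xs) = s" .
  qed
  moreover have tail: "measure (atomic_law xs) {t..}
      = sum_list (map snd (filter (\<lambda>y. t \<le> fst y) xs))" for t
    using measure_atomic_law[OF wf, of "{t..}"] by simp
  \<comment> \<open>Abbreviating the weights keeps the tail computations linear.\<close>
  define u0 up uz v0 vm ve where uv: "u0 = (1 - \<epsilon>) * w_zero" "up = (1 - \<epsilon>) * wp"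
    "uz = (1 - \<epsilon>) * wz" "v0 = \<epsilon> * (1 - km q - ke q)" "vm = \<epsilon> * km q" "ve = \<epsilon> * ke q"
  have m: "0 \<le> up" "0 \<le> uz" "0 \<le> v0" "0 \<le> vm" "0 \<le> ve"
    unfolding uv using w q \<epsilon> by auto
  have sums: "v0 + vm + ve = \<epsilon>" "uz \<le> wz"
    unfolding uv using w \<epsilon> by (auto simp: algebra_simps)
  have xs: "xs = [(0, u0), (q, up), (z, uz), (0, v0), (\<mu>, vm), (\<beta>, ve)]"
    by (simp add: xs_def uv)
  have "measure (atomic_law xs) {p..} \<le> wz + \<epsilon>"
    unfolding tail unfolding xs using p q m sums by simp
  moreover have "(1 - \<epsilon>) * (wp + wz) \<le> measure (atomic_law xs) {q..}"
    unfolding tail unfolding xs distrib_left uv(2,3)[symmetric] using p q m by simp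
  moreover have "(1 - \<epsilon>) * wz \<le> measure (atomic_law xs) {z..}"
    unfolding tail unfolding xs uv(3)[symmetric] using p q m by simp
  ultimately show ?thesis using that q by blast
qed

section \<open>Lower bounds for all laws\<close>

text \<open>
  This is Markov's inequality; it makes the supremum in \<open>OPT\<close> a genuine one.
\<close>

lemma revenue_le_mean:
  assumes "M \<in> laws"
  shows "t * measure M {t..} \<le> \<mu>"
proof -
  have "0 + (-1) * \<mu> + 0 * s \<le> 0 + (- t) * measure M {t..} + 0 * measure M {0..}"
    by (rule expectation_le[OF assms]) (auto split: split_indicator)
  then show ?thesis by simp
qed

lemma bdd_above_revenue:
  "M \<in> laws \<Longrightarrow> bdd_above ((\<lambda>t. t * measure M {t..}) ` {0<..})"
  using revenue_le_mean by (auto intro!: bdd_aboveI)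

lemma revenue_le_OPT:
  assumes "M \<in> laws" "0 < t"
  shows "t * measure M {t..} \<le> OPT M"
  unfolding OPT_def by (rule cSUP_upper[OF _ bdd_above_revenue]) (use assms in auto)

text \<open>
  Valuations below \<open>\<mu>/2\<close> contribute at most \<open>\<mu>/2\<close> to the mean, so the price \<open>\<mu>/2\<close> sells with positive
  probability.
\<close>

lemma OPT_pos:
  assumes "M \<in> laws"
  shows "0 < OPT M"
proof -
  have "0 + 1 * \<mu> + 0 * s \<le> \<mu> / 2 + \<beta> * measure M {\<mu>/2..} + 0 * measure M {0..}"
    by (rule expectation_le[OF assms]) (use mean_pos in \<open>auto split: split_indicator\<close>)
  then have "0 < \<beta> * measure M {\<mu>/2..}" using mean_pos by simp
  then have "0 < measure M {\<mu>/2..}"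
    using mean_pos mean_less by (simp add: zero_less_mult_iff)
  then have "0 < \<mu>/2 * measure M {\<mu>/2..}" using mean_pos by simp
  also have "\<dots> \<le> OPT M" by (rule revenue_le_OPT[OF assms]) (use mean_pos in simp)
  finally show ?thesis .
qed

text \<open>
  Let \<open>f\<close> be the height of \<open>\<phi>\<close> above a tangent. With the tangent at \<open>z\<close>, the function
  \<open>1 - f x / f p\<close> is at most the indicator of \<open>{p..}\<close> with equality at the atoms (read at \<open>p\<close> as
  the limit from the left), which bounds the tail at \<open>p\<close>. With the tangent at \<open>p\<close>, the function
  \<open>z f x / f z\<close> is nonnegative and dominates \<open>x\<close> for \<open>x \<ge> z\<close>, because the
  convex function \<open>z f x / f z - x\<close> is negative at \<open>p\<close> and vanishes at \<open>z\<close>; hence no price above \<open>z\<close> earns more than \<open>z wz\<close> under any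
  admissible law. Competing prices \<open>t \<le> p\<close> earn at most \<open>p\<close>, and prices between \<open>p\<close> and \<open>z\<close> sell
  at most as often as \<open>p\<close>.
\<close>

lemma lower_bounds_two_atoms:
  fixes p z wp wz :: real
  assumes M: "M \<in> laws"
    and pz: "0 < p" "p < z" "z < \<beta>"
    and w: "0 \<le> wp" "0 \<le> wz" "wp + wz = 1"
    and mean: "p * wp + z * wz = \<mu>" and moment: "\<phi> p * wp + \<phi> z * wz = s"
  shows "wz \<le> measure M {p..}"
    and "0 < t \<Longrightarrow> wz * (t * measure M {t..}) \<le> max p (z * wz) * measure M {p..}"
proof -
  interpret real_distribution M using M by (simp add: ambiguity_set_def)
  show tail: "wz \<le> measure M {p..}"
  proof -
    obtain c where c: "\<And>x. x \<in> {0..\<beta>} \<Longrightarrow> x \<noteq> z \<Longrightarrow> \<phi> z + c * (x - z) < \<phi> x"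
      using strict_tangent[of z] pz by force
    define f where "f x = \<phi> x - \<phi> z - c * (x - z)" for x
    have f_nonneg: "0 \<le> f x" if "0 \<le> x" "x \<le> \<beta>" for x
      using c[of x] that by (cases "x = z") (auto simp: f_def)
    have fp: "0 < f p" using c[of p] pz by (simp add: f_def)
    have f_left: "f p \<le> f x" if "0 \<le> x" "x < p" for x
    proof -
      have "(z - x) * \<phi> p < (z - p) * \<phi> x + (p - x) * \<phi> z"
        by (rule three_chord[OF strictly_convex]) (use that pz in auto)
      then have "(z - x) * f p \<le> (z - p) * f x"
        by (simp add: f_def algebra_simps)
      also have "\<dots> \<le> (z - x) * f x"
        using that pz f_nonneg[of x] by (intro mult_right_mono) auto
      finally show ?thesis using that pz by simp
    qed
    have "(f p + \<phi> z - c * z) + c * \<mu> + (-1) * s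
        \<le> 0 + f p * measure M {p..} + 0 * measure M {0..}"
    proof (rule expectation_le[OF M])
      fix x assume x: "0 \<le> x" "x \<le> \<beta>"
      have "f p - f x \<le> f p * indicator {p..} x"
        using f_left[of x] f_nonneg[of x] x by (auto split: split_indicator)
      then show "f p + \<phi> z - c * z + c * x + -1 * \<phi> x
          \<le> 0 + f p * indicator {p..} x + 0 * indicator {0..} x"
        by (simp add: f_def algebra_simps)
    qed
    moreover have "(f p + \<phi> z - c * z) + c * \<mu> + (-1) * s = f p * wz"
    proof -
      have wp: "wp = 1 - wz" using w by simp
      show ?thesis
        unfolding mean[symmetric] moment[symmetric] wp f_def by (simp add: algebra_simps)
    qed
    ultimately have "f p * wz \<le> f p * measure M {p..}" by simp
    then show ?thesis using fp by simp
  qed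
  have high: "t * measure M {t..} \<le> z * wz" if "z < t" for t
  proof -
    obtain c where c: "\<And>x. x \<in> {0..\<beta>} \<Longrightarrow> x \<noteq> p \<Longrightarrow> \<phi> p + c * (x - p) < \<phi> x"
      using strict_tangent[of p] pz by force
    define f where "f x = \<phi> x - \<phi> p - c * (x - p)" for x
    have f_nonneg: "0 \<le> f x" if "0 \<le> x" "x \<le> \<beta>" for x
      using c[of x] that by (cases "x = p") (auto simp: f_def)
    have fz: "0 < f z" using c[of z] pz by (simp add: f_def)
    have f_right: "f z * x \<le> z * f x" if "z < x" "x \<le> \<beta>" for x
    proof -
      have "(x - p) * \<phi> z < (x - z) * \<phi> p + (z - p) * \<phi> x"
        by (rule three_chord[OF strictly_convex]) (use that pz in auto)
      then have *: "(x - p) * f z \<le> (z - p) * f x"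
        by (simp add: f_def algebra_simps)
      have "x * (z - p) \<le> z * (x - p)" using that pz by (simp add: algebra_simps)
      then have "x * (z - p) * f z \<le> z * (x - p) * f z"
        using fz by (intro mult_right_mono) auto
      also have "\<dots> \<le> z * ((z - p) * f x)"
        using * pz by (simp add: mult.assoc)
      finally have "(z - p) * (f z * x) \<le> (z - p) * (z * f x)" by (simp add: mult_ac)
      then show ?thesis using pz by simp
    qed
    have "z * (\<phi> p - c * p) + z * c * \<mu> + (- z) * s
        \<le> 0 + (- f z * t) * measure M {t..} + 0 * measure M {0..}"
    proof (rule expectation_le[OF M])
      fix x assume x: "0 \<le> x" "x \<le> \<beta>"
      have "f z * t * indicator {t..} x \<le> z * f x"
      proof (cases "t \<le> x")
        case True
        have "f z * t \<le> f z * x" using fz True by simp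
        then show ?thesis using f_right[of x] x True \<open>z < t\<close> by simp
      next
        case False
        then show ?thesis using f_nonneg[of x] x pz by simp
      qed
      then show "z * (\<phi> p - c * p) + z * c * x + - z * \<phi> x
          \<le> 0 + - f z * t * indicator {t..} x + 0 * indicator {0..} x"
        by (simp add: f_def algebra_simps)
    qed
    moreover have "z * (\<phi> p - c * p) + z * c * \<mu> + (- z) * s = - (f z * (z * wz))"
    proof -
      have wp: "wp = 1 - wz" using w by simp
      show ?thesis
        unfolding mean[symmetric] moment[symmetric] wp f_def by (simp add: algebra_simps)
    qed
    ultimately have "f z * (t * measure M {t..}) \<le> f z * (z * wz)" by (simp add: mult_ac)
    then show ?thesis using fz by simp
  qed
  show "wz * (t * measure M {t..}) \<le> max p (z * wz) * measure M {p..}" if t: "0 < t"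
  proof -
    consider "t \<le> p" | "p < t" "t \<le> z" | "z < t" by linarith
    then show ?thesis
    proof cases
      case 1
      have "t * measure M {t..} \<le> p * 1" using 1 t by (intro mult_mono) auto
      then have "wz * (t * measure M {t..}) \<le> measure M {p..} * p"
        using tail w t by (intro mult_mono) auto
      also have "\<dots> \<le> measure M {p..} * max p (z * wz)" by (intro mult_left_mono) auto
      finally show ?thesis by (simp add: mult.commute)
    next
      case 2
      have "t * measure M {t..} \<le> z * measure M {p..}"
        using 2 t by (intro mult_mono finite_measure_mono) auto
      from mult_left_mono[OF this w(2)]
      have "wz * (t * measure M {t..}) \<le> (z * wz) * measure M {p..}"
        by (simp add: mult_ac)
      also have "\<dots> \<le> max p (z * wz) * measure M {p..}" by (intro mult_right_mono) auto
      finally show ?thesis .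
    next
      case 3
      have "wz * (t * measure M {t..}) \<le> measure M {p..} * (z * wz)"
        by (rule mult_mono[OF tail high[OF 3]]) (use t in auto)
      also have "\<dots> \<le> measure M {p..} * max p (z * wz)" by (intro mult_left_mono) auto
      finally show ?thesis by (simp add: mult.commute)
    qed
  qed
qed

text \<open>
  Let \<open>g\<close> be the combination of \<open>1\<close>, \<open>x\<close> and \<open>\<phi>\<close> with values \<open>0, 0, 1\<close> at the atoms \<open>0, p, \<beta>\<close>. It is
  convex, so it is nonpositive before \<open>p\<close> and below the chord after \<open>p\<close>, and its expectation is
  \<open>wz\<close>; this is the tail bound. For a competing price \<open>t < p\<close> the right test function is
  \<open>\<mu> g x - wz x\<close>: its expectation is 0, and it interpolates the values \<open>0\<close>, \<open>- p wz\<close>, \<open>p wp\<close> that the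
  combination \<open>p (wp + wz) 1{x \<ge> p} - wz t 1{x \<ge> t}\<close> takes at \<open>0\<close>, just below \<open>p\<close> and at \<open>\<beta>\<close> as \<open>t\<close> tends to \<open>p\<close>.
  A price \<open>t \<ge> p\<close> sells at most as often as \<open>p\<close> and earns nothing beyond \<open>\<beta>\<close>.
\<close>

lemma lower_bounds_three_atoms:
  fixes p w_zero wp wz :: real
  assumes M: "M \<in> laws"
    and p: "0 < p" "p < \<beta>"
    and w: "0 \<le> wp" "0 \<le> wz" "w_zero + wp + wz = 1"
    and mean: "p * wp + \<beta> * wz = \<mu>" and moment: "\<phi> 0 * w_zero + \<phi> p * wp + \<phi> \<beta> * wz = s"
  shows "wz \<le> measure M {p..}"
    and "0 < t \<Longrightarrow> wz * (t * measure M {t..}) \<le> max (p * (wp + wz)) (\<beta> * wz) * measure M {p..}"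
proof -
  interpret real_distribution M using M by (simp add: ambiguity_set_def)
  define N where "N = gap p / p"
  have N: "0 < N" using gap_pos[OF p] p by (simp add: N_def)
  define k where "k = (\<phi> p - \<phi> 0) / p"
  define g where "g x = (\<phi> x - \<phi> 0 - k * x) / N" for x
  have g_left: "g x \<le> 0" if "0 \<le> x" "x < p" for x
  proof (cases "x = 0")
    case False
    have "(p - 0) * \<phi> x < (p - x) * \<phi> 0 + (x - 0) * \<phi> p"
      by (rule three_chord[OF strictly_convex]) (use that False p in auto)
    then have "\<phi> x - \<phi> 0 - k * x \<le> 0"
      using p by (simp add: k_def field_simps)
    then show ?thesis using N by (simp add: g_def divide_nonpos_pos)
  qed (simp add: g_def)
  have g_p: "g p = 0" using p by (simp add: g_def k_def)
  have g_end: "g \<beta> = 1" 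
    using N p unfolding g_def N_def gap_def k_def by (simp add: field_simps)
  have g_right: "(\<beta> - p) * g x \<le> x - p" if "p \<le> x" "x \<le> \<beta>" for x
  proof (cases "x = p \<or> x = \<beta>")
    case True
    then show ?thesis using g_p g_end by auto
  next
    case False
    have "(\<beta> - p) * \<phi> x < (\<beta> - x) * \<phi> p + (x - p) * \<phi> \<beta>"
      by (rule three_chord[OF strictly_convex]) (use that False p in auto)
    moreover have "(\<beta> - p) * \<phi> x = (\<beta> - p) * (N * g x + \<phi> 0 + k * x)"
      "\<phi> p = N * g p + \<phi> 0 + k * p"
      "\<phi> \<beta> = N * g \<beta> + \<phi> 0 + k * \<beta>"
      using N by (auto simp: g_def)
    ultimately have "(\<beta> - p) * (N * g x) < (\<beta> - x) * (N * g p) + (x - p) * (N * g \<beta>)"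
      by (smt (verit) ring_distribs mult.commute mult.left_commute)
    then have "N * ((\<beta> - p) * g x) < N * (x - p)"
      by (simp add: g_p g_end mult_ac)
    then show ?thesis using N by simp
  qed
  have g_mean: "- \<phi> 0 / N + - (k / N) * \<mu> + 1 / N * s = wz"
  proof -
    have w_zero: "w_zero = 1 - wp - wz" using w by simp
    have "- \<phi> 0 / N + - (k / N) * \<mu> + 1 / N * s
      = w_zero * g 0 + wp * g p + wz * g \<beta>"
      unfolding mean[symmetric] moment[symmetric] w_zero g_def using N p
      by (simp add: field_simps)
    also have "\<dots> = wz" unfolding g_p g_end by (simp add: g_def)
    finally show ?thesis .
  qed
  have g_eq: "- \<phi> 0 / N + - (k / N) * x + 1 / N * \<phi> x = g x" for x
    using N by (simp add: g_def field_simps)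
  have "- \<phi> 0 / N + - (k / N) * \<mu> + 1 / N * s
      \<le> 0 + 1 * measure M {p..} + 0 * measure M {0..}"
  proof (rule expectation_le[OF M], unfold g_eq)
    fix x assume x: "0 \<le> x" "x \<le> \<beta>"
    have "g x \<le> 1" if "p \<le> x"
    proof -
      have "(\<beta> - p) * g x \<le> (\<beta> - p) * 1" using g_right[of x] x that by simp
      then show ?thesis using p by (simp only: mult_le_cancel_left_pos)
    qed
    then show "g x \<le> 0 + 1 * indicator {p..} x + 0 * indicator {0..} x"
      using g_left[of x] x by (auto split: split_indicator)
  qed
  then show tail: "wz \<le> measure M {p..}" unfolding g_mean by simp
  show "wz * (t * measure M {t..}) \<le> max (p * (wp + wz)) (\<beta> * wz) * measure M {p..}"
    if t: "0 < t"
  proof (cases "t < p")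
    case True
    have aff: "\<mu> * (- \<phi> 0 / N) + (\<mu> * - (k / N) - wz) * y + \<mu> * (1 / N) * r
      = \<mu> * (- \<phi> 0 / N + - (k / N) * y + 1 / N * r) - wz * y" for y r
      by (simp only: ring_distribs mult.assoc diff_conv_add_uminus mult_minus_left)
    have "\<mu> * (- \<phi> 0 / N) + (\<mu> * - (k / N) - wz) * \<mu> + \<mu> * (1 / N) * s
        \<le> 0 + (p * (wp + wz)) * measure M {p..} + (- (wz * t)) * measure M {t..}"
    proof (rule expectation_le[OF M], unfold aff g_eq)
      fix x assume x: "0 \<le> x" "x \<le> \<beta>"
      show "\<mu> * g x - wz * x
        \<le> 0 + (p * (wp + wz)) * indicator {p..} x + (- (wz * t)) * indicator {t..} x"
      proof (cases "x < p")
        case left: True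
        have "\<mu> * g x \<le> 0"
          using g_left[of x] x left mean_pos by (simp add: mult_nonneg_nonpos)
        moreover have "wz * t \<le> wz * x" if "t \<le> x"
          using that w by (intro mult_left_mono) auto
        moreover have "0 \<le> wz * x" using w x by simp
        ultimately show ?thesis using left by (auto split: split_indicator)
      next
        case False
        \<comment> \<open>The chord of the test function runs from \<open>(p, - p wz)\<close> up to \<open>(\<beta>, p wp)\<close>.\<close>
        have "(\<beta> - p) * (\<mu> * g x - wz * x) = \<mu> * ((\<beta> - p) * g x) - (\<beta> - p) * (wz * x)"
          by (simp add: algebra_simps)
        also have "\<dots> \<le> \<mu> * (x - p) - (\<beta> - p) * (wz * x)"
          using g_right[of x] False x mean_pos by simp
        also have "\<dots> = (\<beta> - p) * (p * wp) - (\<beta> - x) * (p * (wp + wz))"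
          unfolding mean[symmetric] by (simp add: algebra_simps)
        also have "\<dots> \<le> (\<beta> - p) * (p * wp)" using x p w by simp
        finally have "\<mu> * g x - wz * x \<le> p * wp" using p by simp
        moreover have "wz * t \<le> wz * p" using True w by (intro mult_left_mono) auto
        ultimately show ?thesis using False True by (simp add: algebra_simps)
      qed
    qed
    then have "0 \<le> (p * (wp + wz)) * measure M {p..} - wz * t * measure M {t..}"
      unfolding aff g_mean by simp
    moreover have "(p * (wp + wz)) * measure M {p..}
        \<le> max (p * (wp + wz)) (\<beta> * wz) * measure M {p..}"
      by (intro mult_right_mono) auto
    ultimately show ?thesis by (simp add: mult.assoc)
  next
    case False
    have null: "measure M {t..} = 0" if "\<beta> < t"
    proof -
      have "measure M {0..\<beta>} = 1" using M by (simp add: ambiguity_set_def)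
      then have "measure M (space M - {0..\<beta>}) = 0" by (subst prob_compl) auto
      moreover have "measure M {t..} \<le> measure M (space M - {0..\<beta>})"
        using that space_eq_univ by (intro finite_measure_mono) auto
      ultimately show ?thesis by (simp add: measure_le_0_iff)
    qed
    have "t * measure M {t..} \<le> \<beta> * measure M {p..}"
    proof (cases "t \<le> \<beta>")
      case True
      then show ?thesis using t False by (intro mult_mono finite_measure_mono) auto
    qed (use null p in simp)
    from mult_left_mono[OF this w(2)]
    have "wz * (t * measure M {t..}) \<le> \<beta> * wz * measure M {p..}"
      by (simp add: mult_ac)
    also have "\<dots> \<le> max (p * (wp + wz)) (\<beta> * wz) * measure M {p..}"
      by (intro mult_right_mono) auto
    finally show ?thesis .
  qed
qed

section \<open>One sequence for both objectives\<close>

definition shared_worst_case :: "real \<Rightarrow> bool" where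
  "shared_worst_case p \<longleftrightarrow> (\<exists>P. (\<forall>n::nat. P n \<in> laws) \<and>
    (\<lambda>n. CR p (P n)) \<longlonglongrightarrow> (INF M\<in>laws. CR p M) \<and>
    (\<lambda>n. REV p (P n)) \<longlonglongrightarrow> (INF M\<in>laws. REV p M))"

lemma INF_laws_eqI:
  fixes f :: "real measure \<Rightarrow> real"
  assumes "\<And>M. M \<in> laws \<Longrightarrow> L \<le> f M"
    and P: "\<And>n::nat. P n \<in> laws" and lim: "(\<lambda>n. f (P n)) \<longlonglongrightarrow> L"
  shows "(INF M\<in>laws. f M) = L"
proof (rule antisym)
  have "bdd_below (f ` laws)" using assms(1) by (auto intro!: bdd_belowI)
  then have "(INF M\<in>laws. f M) \<le> f (P n)" for n
    using P by (intro cINF_lower) auto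
  then show "(INF M\<in>laws. f M) \<le> L" by (intro LIMSEQ_le_const[OF lim]) auto
  show "L \<le> (INF M\<in>laws. f M)" using assms(1) P by (intro cINF_greatest) auto
qed

text \<open>
  The approximating laws with \<open>\<epsilon> = 1 / (n + 2)\<close> meet both lower bounds in the limit. For the
  ratio only a lower estimate of \<open>OPT\<close> is needed, and the two candidate prices \<open>q n\<close> and \<open>z\<close>
  already give one that tends to \<open>V\<close>.
\<close>

lemma common_worst_case:
  fixes p z w_zero wp wz :: real
  assumes p: "0 < p" "p < z" and z: "z \<le> \<beta>"
    and w: "0 \<le> w_zero" "0 < wp" "0 \<le> wz" "w_zero + wp + wz = 1"
    and mean: "p * wp + z * wz = \<mu>"
    and moment: "\<phi> 0 * w_zero + \<phi> p * wp + \<phi> z * wz = s"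
    and tail: "\<And>M. M \<in> laws \<Longrightarrow> wz \<le> measure M {p..}"
    and ratio: "\<And>M t. M \<in> laws \<Longrightarrow> 0 < t \<Longrightarrow>
      wz * (t * measure M {t..}) \<le> max (p * (wp + wz)) (z * wz) * measure M {p..}"
  shows "shared_worst_case p"
proof -
  define V where "V = max (p * (wp + wz)) (z * wz)"
  have V: "0 < V" unfolding V_def using p w by (intro less_max_iff_disj[THEN iffD2]) auto
  define e :: "nat \<Rightarrow> real" where "e n = 1 / (real n + 2)" for n
  have e: "0 < e n" "e n < 1" for n by (auto simp: e_def)
  have e_lim: "e \<longlonglongrightarrow> 0" unfolding e_def by real_asymp
  have "\<exists>M q. M \<in> laws \<and> 0 < q \<and> p - e n < q \<and> measure M {p..} \<le> wz + e n \<and>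
    (1 - e n) * (wp + wz) \<le> measure M {q..} \<and> (1 - e n) * wz \<le> measure M {z..}" for n
    using approximating_law[OF p z w(1) _ w(3,4) mean moment e[of n]] w(2)
    by (metis less_imp_le)
  then obtain P q where P: "\<And>n. P n \<in> laws" and q: "\<And>n. 0 < q n" "\<And>n. p - e n < q n"
    and upper: "\<And>n. measure (P n) {p..} \<le> wz + e n"
    and lower_q: "\<And>n. (1 - e n) * (wp + wz) \<le> measure (P n) {q n..}"
    and lower_z: "\<And>n. (1 - e n) * wz \<le> measure (P n) {z..}"
    by metis
  have REV_ge: "p * wz \<le> REV p M" if "M \<in> laws" for M
    unfolding REV_def using tail[OF that] p by simp
  have REV_le: "REV p (P n) \<le> p * (wz + e n)" for n
    unfolding REV_def using upper p by simp
  have "(\<lambda>n. p * (wz + e n)) \<longlonglongrightarrow> p * (wz + 0)" by (intro tendsto_intros e_lim)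
  then have REV_upper_lim: "(\<lambda>n. p * (wz + e n)) \<longlonglongrightarrow> p * wz" by simp
  have REV_lim: "(\<lambda>n. REV p (P n)) \<longlonglongrightarrow> p * wz"
  proof (rule tendsto_sandwich[OF _ _ tendsto_const REV_upper_lim])
    show "eventually (\<lambda>n. p * wz \<le> REV p (P n)) sequentially"
      by (intro always_eventually allI REV_ge P)
    show "eventually (\<lambda>n. REV p (P n) \<le> p * (wz + e n)) sequentially"
      by (intro always_eventually allI REV_le)
  qed
  have CR_ge: "p * wz / V \<le> CR p M" if M: "M \<in> laws" for M
  proof -
    have "wz * OPT M \<le> V * measure M {p..}"
    proof (cases "wz = 0")
      case True
      then show ?thesis using V by simp
    next
      case False
      then have "0 < wz" using w by simp
      have "OPT M \<le> V * measure M {p..} / wz"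
        unfolding OPT_def
      proof (rule cSUP_least)
        fix t :: real assume "t \<in> {0<..}"
        then show "t * measure M {t..} \<le> V * measure M {p..} / wz"
          using ratio[OF M, of t] \<open>0 < wz\<close> by (simp add: V_def pos_le_divide_eq mult_ac)
      qed auto
      then show ?thesis using \<open>0 < wz\<close> by (simp add: pos_le_divide_eq mult_ac)
    qed
    then have "p * (wz * OPT M) \<le> p * (V * measure M {p..})" using p by simp
    then show ?thesis
      unfolding CR_def REV_def pos_divide_le_eq[OF V] times_divide_eq_left
        pos_le_divide_eq[OF OPT_pos[OF M]]
      by (simp only: mult_ac)
  qed
  define v where "v n = (1 - e n) * max ((p - e n) * (wp + wz)) (z * wz)" for n
  have v_le: "v n \<le> OPT (P n)" for n
  proof -
    have "(1 - e n) * ((p - e n) * (wp + wz)) = (p - e n) * ((1 - e n) * (wp + wz))"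
      by (rule mult.left_commute)
    also have "\<dots> \<le> q n * ((1 - e n) * (wp + wz))"
      using q(2)[of n] e[of n] w by (intro mult_right_mono) auto
    also have "\<dots> \<le> q n * measure (P n) {q n..}" using lower_q q(1)[of n] by simp
    also have "\<dots> \<le> OPT (P n)" by (rule revenue_le_OPT[OF P q(1)])
    finally have A: "(1 - e n) * ((p - e n) * (wp + wz)) \<le> OPT (P n)" .
    have "(1 - e n) * (z * wz) = z * ((1 - e n) * wz)" by simp
    also have "\<dots> \<le> z * measure (P n) {z..}" using lower_z p by simp
    also have "\<dots> \<le> OPT (P n)" using p by (intro revenue_le_OPT[OF P]) simp
    finally show ?thesis using A by (simp add: v_def max_def)
  qed
  have "v \<longlonglongrightarrow> (1 - 0) * max ((p - 0) * (wp + wz)) (z * wz)"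
    unfolding v_def by (intro tendsto_intros tendsto_max e_lim)
  then have v_lim: "v \<longlonglongrightarrow> V" by (simp add: V_def)
  have "(\<lambda>n. p * (wz + e n) / v n) \<longlonglongrightarrow> p * (wz + 0) / V"
    using V by (intro tendsto_intros e_lim v_lim) auto
  then have upper_lim: "(\<lambda>n. p * (wz + e n) / v n) \<longlonglongrightarrow> p * wz / V" by simp
  have "eventually (\<lambda>n. 0 < v n) sequentially" using order_tendstoD(1)[OF v_lim V] .
  then have "eventually (\<lambda>n. CR p (P n) \<le> p * (wz + e n) / v n) sequentially"
  proof eventually_elim
    case (elim n)
    have "0 \<le> REV p (P n)" using p by (simp add: REV_def)
    then show ?case
      unfolding CR_def using elim REV_le[of n] v_le[of n] by (intro frac_le) auto
  qed
  then have CR_lim: "(\<lambda>n. CR p (P n)) \<longlonglongrightarrow> p * wz / V"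
  proof (rule tendsto_sandwich[OF _ _ tendsto_const upper_lim, rotated])
    show "eventually (\<lambda>n. p * wz / V \<le> CR p (P n)) sequentially"
      by (intro always_eventually allI CR_ge P)
  qed
  have "(INF M\<in>laws. REV p M) = p * wz" "(INF M\<in>laws. CR p M) = p * wz / V"
    by (rule INF_laws_eqI[where P=P], fact REV_ge, fact P, fact REV_lim,
        rule INF_laws_eqI[where P=P], fact CR_ge, fact P, fact CR_lim)
  then show ?thesis
    unfolding shared_worst_case_def using P REV_lim CR_lim by auto
qed

text \<open>
  The second assumption says that the law on \<open>{p, \<beta>}\<close> with mean \<open>\<mu>\<close> has a \<open>\<phi>\<close>-moment above \<open>s\<close>.
  Moving the upper atom from \<open>\<beta>\<close> down to \<open>\<mu>\<close> lowers this moment continuously to \<open>\<phi> \<mu> < s\<close>, so the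
  intermediate value theorem yields the right position \<open>z\<close>.
\<close>

lemma low_price:
  assumes p: "0 < p" "p < \<mu>"
    and above: "s * (\<beta> - p) < \<phi> p * (\<beta> - \<mu>) + \<phi> \<beta> * (\<mu> - p)"
  shows "shared_worst_case p"
proof -
  \<comment> \<open>\<open>F z / (z - p)\<close> is the excess of the \<open>\<phi>\<close>-moment of the law on \<open>{p, z}\<close> over \<open>s\<close>.\<close>
  define F where "F z = \<phi> p * (z - \<mu>) + \<phi> z * (\<mu> - p) - s * (z - p)" for z
  have "continuous_on {\<mu>..\<beta>} \<phi>"
    by (rule continuous_on_subset[OF continuous]) (use mean_pos in auto)
  then have cont: "continuous_on {\<mu>..\<beta>} F"
    unfolding F_def by (intro continuous_intros)
  have "F \<mu> = (\<phi> \<mu> - s) * (\<mu> - p)" by (simp add: F_def algebra_simps)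
  then have F_mean: "F \<mu> < 0" using above_graph p by (simp add: mult_neg_pos)
  have F_end: "0 < F \<beta>" using above by (simp add: F_def)
  obtain z where z: "\<mu> \<le> z" "z \<le> \<beta>" "F z = 0"
    using IVT'[OF _ _ _ cont, of 0] F_mean F_end mean_less by auto
  then have strict: "\<mu> < z" "z < \<beta>"
    using F_mean F_end by (auto simp: less_le)
  define wp where "wp = (z - \<mu>) / (z - p)"
  define wz where "wz = (\<mu> - p) / (z - p)"
  have zp: "0 < z - p" using strict p by simp
  have w: "0 < wp" "0 \<le> wz" using strict p by (auto simp: wp_def wz_def)
  have total: "wp + wz = 1"
    unfolding wp_def wz_def add_divide_distrib[symmetric] using zp by simp
  have "p * (z - \<mu>) + z * (\<mu> - p) = \<mu> * (z - p)" by (simp add: algebra_simps)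
  then have mean: "p * wp + z * wz = \<mu>"
    unfolding wp_def wz_def times_divide_eq_right add_divide_distrib[symmetric] using zp by simp
  have "\<phi> p * (z - \<mu>) + \<phi> z * (\<mu> - p) = s * (z - p)" using z by (simp add: F_def)
  then have moment: "\<phi> p * wp + \<phi> z * wz = s"
    unfolding wp_def wz_def times_divide_eq_right add_divide_distrib[symmetric] using zp by simp
  show ?thesis
  proof (rule common_worst_case[where w_zero=0 and wp=wp and wz=wz and z=z])
    fix M assume M: "M \<in> laws"
    note bounds = lower_bounds_two_atoms[OF M _ _ _ _ _ total mean moment]
    show "wz \<le> measure M {p..}" using bounds(1) p strict w by simp
    show "wz * (t * measure M {t..}) \<le> max (p * (wp + wz)) (z * wz) * measure M {p..}"
      if "0 < t" for t
      using bounds(2) that p strict w total by simp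
  qed (use p strict w total mean moment in auto)
qed

text \<open>
  The hypothesis on the weight at \<open>\<beta>\<close> expresses \<open>p \<le> \<tau>\<^sub>2\<close>. The weight at \<open>p\<close> is always positive, so
  only the weight at \<open>0\<close> can fail to be nonnegative. If it is negative, the mean constraint forces
  \<open>p < \<mu>\<close>, and clearing the determinant turns the failure into the hypothesis of the previous lemma.
\<close>

lemma price_up_to_threshold:
  assumes p: "0 < p" "p < \<beta>"
    and e: "0 \<le> end_weight p \<mu> s"
  shows "shared_worst_case p"
proof (cases "mid_weight p \<mu> s + end_weight p \<mu> s \<le> 1")
  case True
  let ?wp = "mid_weight p \<mu> s" and ?wz = "end_weight p \<mu> s"
  have m: "0 < ?wp"
    unfolding mid_weight_def using gap_pos[OF p] below_chord by simp
  have mean: "p * ?wp + \<beta> * ?wz = \<mu>" by (rule weights_moments(1)[OF p])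
  have total: "(1 - ?wp - ?wz) + ?wp + ?wz = 1" by simp
  have moment: "\<phi> 0 * (1 - ?wp - ?wz) + \<phi> p * ?wp + \<phi> \<beta> * ?wz = s"
    using weights_moments(2)[OF p, of \<mu> s] by (simp add: algebra_simps)
  show ?thesis
  proof (rule common_worst_case[where w_zero="1 - ?wp - ?wz" and wp="?wp" and wz="?wz" and z=\<beta>])
    fix M assume M: "M \<in> laws"
    note bounds = lower_bounds_three_atoms[OF M p less_imp_le[OF m] e total mean moment]
    show "?wz \<le> measure M {p..}" by (rule bounds)
    show "?wz * (t * measure M {t..}) \<le> max (p * (?wp + ?wz)) (\<beta> * ?wz) * measure M {p..}"
      if "0 < t" for t
      by (rule bounds(2)[OF that])
  qed (use p m e True mean moment in auto)
next
  case False
  note g = gap_pos[OF p]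
  have "p * (mid_weight p \<mu> s + end_weight p \<mu> s) \<le> p * mid_weight p \<mu> s + \<beta> * end_weight p \<mu> s"
    using p e by (simp add: algebra_simps mult_right_mono)
  also have "\<dots> = \<mu>" by (rule weights_moments(1)[OF p])
  finally have le: "p * (mid_weight p \<mu> s + end_weight p \<mu> s) \<le> \<mu>" .
  have "p * 1 < p * (mid_weight p \<mu> s + end_weight p \<mu> s)"
    using False p by (intro mult_strict_left_mono) auto
  then have p_mean: "p < \<mu>" using le by simp
  have "gap p < gap p * (mid_weight p \<mu> s + end_weight p \<mu> s)"
    using False g by simp
  also have "\<dots> = (\<mu> * (\<phi> \<beta> - \<phi> 0) - \<beta> * (s - \<phi> 0)) + (p * (s - \<phi> 0) - \<mu> * (\<phi> p - \<phi> 0))"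
    unfolding mid_weight_def end_weight_def using g by (simp add: distrib_left)
  finally have "s * (\<beta> - p) < \<phi> p * (\<beta> - \<mu>) + \<phi> \<beta> * (\<mu> - p)"
    by (simp add: gap_def algebra_simps)
  then show ?thesis by (rule low_price[OF p(1) p_mean])
qed

lemma high_price:
  assumes \<tau>: "\<mu> \<le> \<tau>" "\<tau> < \<beta>" "\<mu> * (\<phi> \<tau> - \<phi> 0) = \<tau> * (s - \<phi> 0)"
    and p: "\<tau> < p"
  shows "shared_worst_case p"
proof -
  define xs where "xs = [(0, 1 - \<mu> / \<tau>), (\<tau>, \<mu> / \<tau>)]"
  have \<tau>_pos: "0 < \<tau>" using \<tau> mean_pos by simp
  have wf: "pmf_of_list_wf xs"
    using \<tau> \<tau>_pos mean_pos by (auto simp: xs_def intro!: pmf_of_list_wfI)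
  have M: "atomic_law xs \<in> laws"
  proof (rule atomic_law_in_laws[OF wf])
    show "0 \<le> fst y \<and> fst y \<le> \<beta>" if "y \<in> set xs" for y
      using that \<tau> \<tau>_pos by (auto simp: xs_def)
    show "sum_list (map (\<lambda>y. fst y * snd y) xs) = \<mu>"
      using \<tau>_pos by (simp add: xs_def)
    have "sum_list (map (\<lambda>y. \<phi> (fst y) * snd y) xs) = \<phi> 0 + \<mu> * (\<phi> \<tau> - \<phi> 0) / \<tau>"
      using \<tau>_pos by (simp add: xs_def field_simps)
    then show "sum_list (map (\<lambda>y. \<phi> (fst y) * snd y) xs) = s"
      unfolding \<tau> using \<tau>_pos by simp
  qed
  have zero: "REV p (atomic_law xs) = 0"
    using p \<tau>_pos measure_atomic_law[OF wf, of "{p..}"] by (simp add: REV_def) (simp add: xs_def)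
  then have zero': "CR p (atomic_law xs) = 0" by (simp add: CR_def)
  have REV_nonneg: "0 \<le> REV p M" for M using p \<tau>_pos by (simp add: REV_def)
  have CR_nonneg: "0 \<le> CR p M" if "M \<in> laws" for M
    unfolding CR_def using REV_nonneg OPT_pos[OF that] by simp
  have "(INF M\<in>laws. REV p M) = 0"
    by (rule INF_laws_eqI[where P="\<lambda>_. atomic_law xs"]) (use M zero REV_nonneg in auto)
  moreover have "(INF M\<in>laws. CR p M) = 0"
    by (rule INF_laws_eqI[where P="\<lambda>_. atomic_law xs"]) (use M zero' CR_nonneg in auto)
  ultimately show ?thesis
    unfolding shared_worst_case_def using M zero zero' by (intro exI[of _ "\<lambda>_. atomic_law xs"]) simp
qed

end

theorem theorem3p2:
  fixes \<mu> \<beta> s \<tau>\<^sub>2 p :: real and \<phi> :: "real \<Rightarrow> real"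
  assumes "0 < \<mu>" and "\<mu> < \<beta>"
    and "\<And>x. x \<in> {0..\<beta>} \<Longrightarrow> 0 \<le> \<phi> x"
    and "strictly_convex_on {0..\<beta>} \<phi>"
    and "\<phi> differentiable_on {0..\<beta>}"
    and "\<phi> \<mu> < s"
    and "0 < \<tau>\<^sub>2" and "\<tau>\<^sub>2 < \<beta>"
    and "(\<phi> \<tau>\<^sub>2 - \<phi> 0) / \<tau>\<^sub>2 = (s - \<phi> 0) / \<mu>"
    and "0 < p" and "p \<le> \<beta>"
  shows "\<exists>P :: nat \<Rightarrow> real measure.
      (\<forall>n\<ge>1. P n \<in> ambiguity_set \<mu> s \<beta> \<phi>) \<and>
      (\<lambda>n. CR p (P n)) \<longlonglongrightarrow> (INF M\<in>ambiguity_set \<mu> s \<beta> \<phi>. CR p M) \<and>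
      (\<lambda>n. REV p (P n)) \<longlonglongrightarrow> (INF M\<in>ambiguity_set \<mu> s \<beta> \<phi>. REV p M)"
proof -
  let ?\<tau> = "\<tau>\<^sub>2"
  have eq: "\<mu> * (\<phi> ?\<tau> - \<phi> 0) = ?\<tau> * (s - \<phi> 0)"
    using assms by (simp add: field_simps)
  have chord: "y * (\<phi> x - \<phi> 0) < x * (\<phi> y - \<phi> 0)" if "0 < x" "x < y" "y \<le> \<beta>" for x y
    using three_chord[OF assms(4), of 0 y x] that by (simp add: algebra_simps)
  have "\<beta> * (s - \<phi> 0) < \<mu> * (\<phi> \<beta> - \<phi> 0)"
  proof -
    have "?\<tau> * (\<beta> * (s - \<phi> 0)) = \<mu> * (\<beta> * (\<phi> ?\<tau> - \<phi> 0))"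
      using eq by (simp add: mult.left_commute)
    also have "\<dots> < \<mu> * (?\<tau> * (\<phi> \<beta> - \<phi> 0))"
      using chord[of ?\<tau> \<beta>] assms by simp
    finally have "?\<tau> * (\<beta> * (s - \<phi> 0)) < ?\<tau> * (\<mu> * (\<phi> \<beta> - \<phi> 0))"
      by (simp add: mult.left_commute)
    then show ?thesis using assms(7) by simp
  qed
  then interpret moment_problem \<mu> s \<beta> \<phi>
    using assms by unfold_locales auto
  have "\<mu> \<le> ?\<tau>"
  proof (rule ccontr)
    assume "\<not> \<mu> \<le> ?\<tau>"
    then have "?\<tau> * (s - \<phi> 0) < ?\<tau> * (\<phi> \<mu> - \<phi> 0)"
      using chord[of ?\<tau> \<mu>] assms eq by simp
    then show False using assms by simp
  qed
  have "shared_worst_case p"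
  proof (cases "?\<tau> < p")
    case True
    then show ?thesis using high_price \<open>\<mu> \<le> ?\<tau>\<close> assms eq by blast
  next
    case False
    have "\<mu> * (\<phi> p - \<phi> 0) \<le> p * (s - \<phi> 0)"
    proof (cases "p = ?\<tau>")
      case True
      then show ?thesis using eq by simp
    next
      case neq: False
      have "?\<tau> * (\<mu> * (\<phi> p - \<phi> 0)) = \<mu> * (?\<tau> * (\<phi> p - \<phi> 0))"
        by simp
      also have "\<dots> \<le> \<mu> * (p * (\<phi> ?\<tau> - \<phi> 0))"
        using chord[of p ?\<tau>] neq False assms by simp
      also have "\<dots> = ?\<tau> * (p * (s - \<phi> 0))"
        using eq by (simp add: mult.left_commute)
      finally show ?thesis using assms(7) by simp
    qed
    then have "0 \<le> end_weight p \<mu> s"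
      unfolding end_weight_def using gap_pos[of p] False assms by simp
    then show ?thesis using price_up_to_threshold[of p] False assms by simp
  qed
  then show ?thesis unfolding shared_worst_case_def by blast
qed

end
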